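(* Let $n\ge 2$, let $a_1,\dots,a_n\in\mathbb{C}$, let $R=\mathbb{Z}[a_1,\dots,a_n]\subseteq\mathbb{C}$, let $p(x)=x^n-a_1x^{n-1}-\cdots-a_{n-1}x-a_n$, and consider the universal $sl(n)$ Frobenius extension $R\hookrightarrow A=R[x]/(p(x))$ with its genus-reduction term $g\in A$. If every (complex) root of $p(x)$ is a repeated root (i.e. has multiplicity at least $2$), then $g^2=0$ in $A$.
   Context: The universal $sl(n)$ Frobenius extension is $R\hookrightarrow A=R[x]/(p(x))$ together with the $R$-linear Frobenius form $\varepsilon:A\to R$ given on the basis $\{1,x,\dots,x^{n-1}\}$ by $\varepsilon(x^k)=0$ for $0\le k\le n-2$ and $\varepsilon(x^{n-1})=1$. A dual basis for it is the collection of pairs $(x_k,y_k)=(x^{n-1-k},\,x^k-a_1x^{k-1}-\cdots-a_k)$, $0\le k\le n-1$, which satisfy $a=\sum_k x_k\varepsilon(y_ka)=\sum_k\varepsilon(ax_k)y_k$ for all $a\in A$. The genus-reduction term is $g=\sum_k x_ky_k\in A$; explicitly $g=nx^{n-1}-(n-1)a_1x^{n-2}-(n-2)a_2x^{n-3}-\cdots-a_{n-1}$. The case of indeterminate $a_i$, or of $a_i$ subject to relations, is covered by choosing suitable complex numbers $a_i$. *)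

theory Defs
  imports "HOL-Algebra.Algebraic_Closure_Type" "HOL-Algebra.Generated_Rings"
begin

abbreviation complex_ring :: "complex ring" (\<open>\<C>\<close>) where
  "\<C> \<equiv> ring_of_type_algebra"

text \<open>
  The parameters \<open>a\<^sub>1, \<dots>, a\<^sub>n\<close> are the values \<open>a 1, \<dots>, a n\<close> of a function
  \<open>a :: nat \<Rightarrow> complex\<close>; its other values play no role.
\<close>

definition coeff_ring :: "nat \<Rightarrow> (nat \<Rightarrow> complex) \<Rightarrow> complex set" where
  "coeff_ring n a = generate_ring \<C> (a ` {1..n})"

text \<open>
  \<open>x\<^sup>k - a\<^sub>1 x\<^sup>k\<^sup>-\<^sup>1 - \<dots> - a\<^sub>k\<close>, as the list of its coefficients starting with the leading
  one, which is the representation used by \<^const>\<open>univ_poly\<close>. For \<open>k = n\<close> this is \<open>p\<close>; for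
  \<open>k < n\<close> it represents the dual basis element \<open>y\<^sub>k\<close>.
\<close>
definition sl_poly :: "(nat \<Rightarrow> complex) \<Rightarrow> nat \<Rightarrow> complex list" where
  "sl_poly a k = 1 # map (\<lambda>i. - a i) [1..<Suc k]"

definition sl_ext :: "nat \<Rightarrow> (nat \<Rightarrow> complex) \<Rightarrow> complex list set ring" where
  "sl_ext n a = Rupt\<^bsub>\<C>\<^esub> (coeff_ring n a) (sl_poly a n)"

definition sl_class :: "nat \<Rightarrow> (nat \<Rightarrow> complex) \<Rightarrow> complex list \<Rightarrow> complex list set" where
  "sl_class n a q =
     PIdl\<^bsub>(coeff_ring n a)[X]\<^bsub>\<C>\<^esub>\<^esub> (sl_poly a n) +>\<^bsub>(coeff_ring n a)[X]\<^bsub>\<C>\<^esub>\<^esub> q"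

definition dual_x :: "nat \<Rightarrow> (nat \<Rightarrow> complex) \<Rightarrow> nat \<Rightarrow> complex list set" where
  "dual_x n a k = sl_class n a X\<^bsub>\<C>\<^esub> [^]\<^bsub>sl_ext n a\<^esub> (n - 1 - k)"

definition dual_y :: "nat \<Rightarrow> (nat \<Rightarrow> complex) \<Rightarrow> nat \<Rightarrow> complex list set" where
  "dual_y n a k = sl_class n a (sl_poly a k)"

definition genus_reduction :: "nat \<Rightarrow> (nat \<Rightarrow> complex) \<Rightarrow> complex list set" where
  "genus_reduction n a =
     (\<Oplus>\<^bsub>sl_ext n a\<^esub> k \<in> {..<n}. dual_x n a k \<otimes>\<^bsub>sl_ext n a\<^esub> dual_y n a k)"

lemma complex_ring_simps [simp]:
  "carrier \<C> = UNIV" "monoid.mult \<C> = (*)" "\<one>\<^bsub>\<C>\<^esub> = 1" "\<zero>\<^bsub>\<C>\<^esub> = 0" "add \<C> = (+)"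
  by (simp_all add: ring_of_type_algebra_def)

lemma complex_ring_domain: "domain \<C>"
  using field_from_type_algebra field.axioms(1) by blast

lemma complex_ring_ring: "ring \<C>"
  using ring_from_type_algebra .

lemma complex_ring_a_inv [simp]: "\<ominus>\<^bsub>\<C>\<^esub> z = - z"
  using abelian_group.minus_equality[OF ring.is_abelian_group[OF complex_ring_ring], of "- z" z]
  by simp

lemma coeff_ring_subring: "subring (coeff_ring n a) \<C>"
  unfolding coeff_ring_def by (rule ring.generate_ring_is_subring[OF complex_ring_ring]) simp

lemma sl_poly_closed:
  assumes "k \<le> n"
  shows "sl_poly a k \<in> carrier ((coeff_ring n a)[X]\<^bsub>\<C>\<^esub>)"
proof -
  have "- a i \<in> coeff_ring n a" if "1 \<le> i" "i \<le> k" for i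
    using generate_ring.a_inv[OF generate_ring.incl, of "a i" "a ` {1..n}" \<C>] that assms
    by (simp add: coeff_ring_def)
  moreover have "1 \<in> coeff_ring n a"
    using generate_ring.one[of \<C>] by (simp add: coeff_ring_def)
  ultimately show ?thesis
    unfolding univ_poly_carrier[symmetric] polynomial_def sl_poly_def by auto
qed

lemma sl_class_hom: "ring_hom_ring ((coeff_ring n a)[X]\<^bsub>\<C>\<^esub>) (sl_ext n a) (sl_class n a)"
  using domain.rupture_surj_hom(2)[OF complex_ring_domain coeff_ring_subring sl_poly_closed]
  by (simp add: sl_ext_def sl_class_def [abs_def])

lemma sl_ext_cring: "cring (sl_ext n a)"
proof -
  interpret P: domain "(coeff_ring n a)[X]\<^bsub>\<C>\<^esub>"
    using domain.univ_poly_is_domain[OF complex_ring_domain coeff_ring_subring] .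
  show ?thesis
    unfolding sl_ext_def rupture_def
    using ideal.quotient_is_cring[OF P.cgenideal_ideal P.is_cring] sl_poly_closed by simp
qed

lemma dual_x_closed: "dual_x n a k \<in> carrier (sl_ext n a)"
proof -
  interpret h: ring_hom_ring "(coeff_ring n a)[X]\<^bsub>\<C>\<^esub>" "sl_ext n a" "sl_class n a"
    by (rule sl_class_hom)
  show ?thesis
    unfolding dual_x_def
    using domain.var_closed(1)[OF complex_ring_domain coeff_ring_subring] by simp
qed

lemma dual_y_closed:
  assumes "k < n"
  shows "dual_y n a k \<in> carrier (sl_ext n a)"
proof -
  interpret h: ring_hom_ring "(coeff_ring n a)[X]\<^bsub>\<C>\<^esub>" "sl_ext n a" "sl_class n a"
    by (rule sl_class_hom)
  show ?thesis
    unfolding dual_y_def using sl_poly_closed[of k n a] assms by simp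
qed

lemma genus_reduction_closed: "genus_reduction n a \<in> carrier (sl_ext n a)"
proof -
  interpret A: cring "sl_ext n a" by (rule sl_ext_cring)
  show ?thesis
    unfolding genus_reduction_def
    by (rule A.finsum_closed) (auto intro!: dual_x_closed dual_y_closed)
qed

end

theory Submission
  imports Defs
begin

text \<open>
  The class \<open>g\<close> is represented by the derivative \<open>p'\<close>. A root of \<open>p\<close> of multiplicity
  \<open>m \<ge> 2\<close> is a root of \<open>p'\<^sup>2\<close> of multiplicity \<open>2 (m - 1) \<ge> m\<close>, so \<open>p\<close> divides \<open>p'\<^sup>2\<close>
  over the complex numbers; since \<open>p\<close> is monic, the quotient has coefficients in \<open>R\<close>.
\<close>

section \<open>Transfer from coefficient lists to \<open>complex poly\<close>\<close>

text \<open>Lists of \<^const>\<open>univ_poly\<close> have the leading coefficient first, those of \<^const>\<open>Poly\<close> last.\<close>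
definition complex_poly :: "complex list \<Rightarrow> complex poly" where
  "complex_poly l = Poly (rev l)"

lemma complex_poly_Nil [simp]: "complex_poly [] = 0"
  by (simp add: complex_poly_def)

lemma complex_poly_Cons: "complex_poly (c # l) = monom c (length l) + complex_poly l"
  by (simp add: complex_poly_def Poly_append smult_monom)

lemma complex_nat_pow: "z [^]\<^bsub>\<C>\<^esub> (k::nat) = z ^ k"
proof -
  interpret C: ring \<C> by (rule complex_ring_ring)
  show ?thesis by (induction k) (simp_all add: mult.commute)
qed

lemma complex_finsum: "finite A \<Longrightarrow> finsum \<C> f A = sum f A"
proof -
  interpret C: ring \<C> by (rule complex_ring_ring)
  show "finite A \<Longrightarrow> finsum \<C> f A = sum f A"
    by (induction A rule: finite_induct) simp_all
qed

lemma poly_complex_poly: "poly (complex_poly l) z = ring.eval \<C> l z"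
proof -
  interpret C: ring \<C> by (rule complex_ring_ring)
  show ?thesis
    by (induction l) (simp_all add: complex_poly_Cons poly_monom complex_nat_pow)
qed

text \<open>List arithmetic pads and normalizes its results, which coefficients do not see; sums and
  products can therefore be transferred coefficientwise.\<close>

lemma coeff_complex_poly: "poly.coeff (complex_poly l) i = ring.coeff \<C> l i"
proof -
  interpret C: ring \<C> by (rule complex_ring_ring)
  \<comment> \<open>In the \<open>Cons\<close> case the new leading term sits at degree
    \<open>length l\<close>, where the tail contributes the default value 0.\<close>
  have "C.coeff l i = 0" if "i \<ge> length l" for i l
    using C.coeff_length that by simp
  then show ?thesis
    by (induction l arbitrary: i) (auto simp: complex_poly_Cons)
qed

lemma complex_poly_add:
  "complex_poly (p \<oplus>\<^bsub>K[X]\<^bsub>\<C>\<^esub>\<^esub> q) = complex_poly p + complex_poly q"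
proof -
  interpret C: ring \<C> by (rule complex_ring_ring)
  show ?thesis
    by (rule poly_eqI)
      (simp add: coeff_complex_poly univ_poly_add C.poly_add_coeff del: C.poly_add.simps)
qed

lemma complex_poly_mult:
  "complex_poly (p \<otimes>\<^bsub>K[X]\<^bsub>\<C>\<^esub>\<^esub> q) = complex_poly p * complex_poly q"
proof -
  interpret C: ring \<C> by (rule complex_ring_ring)
  show ?thesis
    by (rule poly_eqI)
      (simp add: coeff_complex_poly univ_poly_mult C.poly_mult_coeff coeff_mult complex_finsum)
qed

lemma complex_poly_one: "complex_poly \<one>\<^bsub>K[X]\<^bsub>\<C>\<^esub>\<^esub> = 1"
  by (simp add: univ_poly_one complex_poly_def)

lemma complex_poly_var: "complex_poly X\<^bsub>\<C>\<^esub> = [:0, 1:]"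
  by (simp add: var_def complex_poly_def)

lemma complex_poly_pow:
  "complex_poly (p [^]\<^bsub>K[X]\<^bsub>\<C>\<^esub>\<^esub> (k::nat)) = complex_poly p ^ k"
  by (induction k) (simp_all add: nat_pow_def complex_poly_one complex_poly_mult mult.commute)

text \<open>Carrier lists have no leading zero, so nothing is stripped. This makes
  \<open>complex_poly\<close> injective on the carrier.\<close>

lemma rev_coeffs_complex_poly:
  assumes "p \<in> carrier (K[X]\<^bsub>\<C>\<^esub>)"
  shows "rev (coeffs (complex_poly p)) = p"
  using assms
  by (cases p) (auto simp: complex_poly_def univ_poly_carrier[symmetric] polynomial_def)

lemma rev_coeffs_closed:
  assumes "\<And>i. poly.coeff q i \<in> K"
  shows "rev (coeffs q) \<in> carrier (K[X]\<^bsub>\<C>\<^esub>)"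
proof (cases "q = 0")
  case False
  then show ?thesis
    using assms
    by (auto simp: univ_poly_carrier[symmetric] polynomial_def hd_rev last_coeffs_eq_coeff_degree
        coeffs_def)
qed (simp add: univ_poly_carrier[symmetric] polynomial_def)

lemma complex_poly_rev_coeffs [simp]: "complex_poly (rev (coeffs q)) = q"
  by (simp add: complex_poly_def)

lemma complex_poly_coeff_closed:
  assumes "subring K \<C>" "p \<in> carrier (K[X]\<^bsub>\<C>\<^esub>)"
  shows "poly.coeff (complex_poly p) i \<in> K"
proof -
  have "set p \<subseteq> K" "0 \<in> K"
    using assms subringE(2)[OF assms(1)]
    by (auto simp: univ_poly_carrier[symmetric] polynomial_def)
  then show ?thesis
    by (auto simp: complex_poly_def coeff_Poly_eq nth_default_def rev_nth)
qed

section \<open>Division by a monic polynomial over a subring\<close>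

text \<open>Long division: since \<open>p\<close> is monic, the leading coefficient of
  \<open>q\<close> is that of \<open>p * q\<close>. Removing the leading term of \<open>q\<close>
  subtracts a \<open>K\<close>-multiple of a shift of \<open>p\<close> from the product and lowers
  the degree.\<close>

lemma monic_quotient_coeffs:
  fixes p q :: "complex poly"
  assumes K: "subring K \<C>" and monic: "Polynomial.lead_coeff p = 1"
    and p: "\<And>i. poly.coeff p i \<in> K" and pq: "\<And>i. poly.coeff (p * q) i \<in> K"
  shows "poly.coeff q i \<in> K"
  using pq
proof (induction "Polynomial.degree q" arbitrary: q i rule: less_induct)
  case less
  have Kadd: "x + y \<in> K" and Kmult: "x * y \<in> K" and Kdiff: "x - y \<in> K"
    if "x \<in> K" "y \<in> K" for x y
    using subringE(5)[OF K, of y] subringE(6)[OF K, of x y] subringE(7)[OF K, of x y]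
      subringE(7)[OF K, of x "- y"] that by auto
  have "0 \<in> K" using subringE(2)[OF K] by simp
  define c where "c = Polynomial.lead_coeff q"
  have c: "c \<in> K"
    using less.prems[of "Polynomial.degree p + Polynomial.degree q"] monic
    by (simp add: c_def coeff_mult_degree_sum)
  define r where "r = q - monom c (Polynomial.degree q)"
  have q: "q = r + monom c (Polynomial.degree q)"
    by (simp add: r_def)
  have "poly.coeff r i \<in> K"
  \<comment> \<open>For constant \<open>q\<close> the remainder is 0, whose degree is again 0, so
    the induction hypothesis does not apply.\<close>
  proof (cases "Polynomial.degree q = 0")
    case True
    then have "r = 0"
      by (auto simp: r_def c_def monom_0 elim!: degree_eq_zeroE)
    then show ?thesis using \<open>0 \<in> K\<close> by simp
  next
    case False
    have "poly.coeff r (Polynomial.degree q) = 0"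
      by (simp add: r_def c_def)
    moreover have "Polynomial.degree r \<le> Polynomial.degree q"
      unfolding r_def by (intro degree_diff_le) (simp_all add: degree_monom_le)
    ultimately have "Polynomial.degree r < Polynomial.degree q"
      using False by (metis degree_0 gr0I leading_coeff_0_iff le_neq_implies_less)
    moreover have "poly.coeff (p * r) j \<in> K" for j
    proof -
      have "p * r = p * q - monom c (Polynomial.degree q) * p"
        by (simp add: r_def algebra_simps)
      then have "poly.coeff (p * r) j =
          poly.coeff (p * q) j -
          (if j < Polynomial.degree q then 0 else c * poly.coeff p (j - Polynomial.degree q))"
        by (simp add: coeff_monom_mult not_less)
      then show ?thesis
        using less.prems[of j] p c \<open>0 \<in> K\<close> by (auto intro!: Kdiff Kmult)
    qed
    ultimately show ?thesis by (rule less.hyps)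
  qed
  then show ?case
    by (subst q) (use c \<open>0 \<in> K\<close> in \<open>auto intro!: Kadd\<close>)
qed

section \<open>Divisibility over the complex numbers by root orders\<close>

lemma prod_dvd_of_pairwise_coprime:
  fixes f :: "'b \<Rightarrow> 'a::semiring_gcd"
  assumes "finite A" "\<And>i. i \<in> A \<Longrightarrow> f i dvd q"
    and "\<And>i j. i \<in> A \<Longrightarrow> j \<in> A \<Longrightarrow> i \<noteq> j \<Longrightarrow> coprime (f i) (f j)"
  shows "prod f A dvd q"
  using assms
  by (induction A rule: finite_induct) (auto intro!: divides_mult prod_coprime_right)

lemma coprime_linear_complex_poly:
  fixes z w :: complex
  assumes "z \<noteq> w"
  shows "coprime [:- z, 1:] [:- w, 1:]"
proof (rule coprimeI)
  fix d assume "d dvd [:- z, 1:]" "d dvd [:- w, 1:]"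
  then have "d dvd [:- z, 1:] - [:- w, 1:]" by (rule dvd_diff)
  then have "d dvd [:w - z:]" by simp
  moreover have "is_unit [:w - z:]" using assms by (simp add: is_unit_pCons_iff)
  ultimately show "is_unit d" by (rule dvd_trans)
qed

text \<open>Up to its leading coefficient, a unit, \<open>p\<close> is a product of powers of linear
  factors for distinct roots. These powers are pairwise coprime and each divides
  \<open>q\<close>.\<close>

lemma dvd_of_order_le:
  fixes p q :: "complex poly"
  assumes "p \<noteq> 0" "q \<noteq> 0" "\<And>z. poly p z = 0 \<Longrightarrow> order z p \<le> order z q"
  shows "p dvd q"
proof -
  have "(\<Prod>z | poly p z = 0. [:- z, 1:] ^ order z p) dvd q"
  proof (rule prod_dvd_of_pairwise_coprime)
    show "finite {z. poly p z = 0}" using assms(1) by (rule poly_roots_finite)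
    show "[:- z, 1:] ^ order z p dvd q" if "z \<in> {z. poly p z = 0}" for z
      using assms(2,3) that by (simp add: order_divides)
    show "coprime ([:- z, 1:] ^ order z p) ([:- w, 1:] ^ order w p)" if "z \<noteq> w" for z w
      using coprime_linear_complex_poly[OF that] by simp
  qed
  then have "smult (Polynomial.lead_coeff p) (\<Prod>z | poly p z = 0. [:- z, 1:] ^ order z p) dvd q"
    using assms(1) by (simp add: smult_dvd)
  then show ?thesis by (simp add: complex_poly_decompose)
qed

lemma dvd_pderiv_squared:
  fixes p :: "complex poly"
  assumes "p \<noteq> 0" "\<And>z. poly p z = 0 \<Longrightarrow> order z p \<ge> 2"
  shows "p dvd (pderiv p)\<^sup>2"
\<comment> \<open>Orders are compared for nonzero polynomials; a vanishing derivative is divisible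
  by anything.\<close>
proof (cases "pderiv p = 0")
  case False
  show ?thesis
  proof (rule dvd_of_order_le)
    fix z assume "poly p z = 0"
    with assms have "order z p = Suc (order z (pderiv p))" "order z p \<ge> 2"
      by (simp_all add: order_pderiv)
    then show "order z p \<le> order z ((pderiv p)\<^sup>2)"
      using False by (simp add: power2_eq_square order_mult)
  qed (use assms False in auto)
qed simp

section \<open>The genus-reduction term as the class of the derivative\<close>

lemma complex_poly_sl_poly_Suc:
  "complex_poly (sl_poly a (Suc k)) = [:0, 1:] * complex_poly (sl_poly a k) - [:a (Suc k):]"
  by (simp add: complex_poly_def sl_poly_def)

text \<open>
  Writing \<open>y\<^sub>k\<close> for \<open>x\<^sup>k - a\<^sub>1 x\<^sup>k\<^sup>-\<^sup>1 - \<dots> - a\<^sub>k\<close>, the recursion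
  \<open>y\<^sub>k\<^sub>+\<^sub>1 = x y\<^sub>k - a\<^sub>k\<^sub>+\<^sub>1\<close> differentiates to \<open>y\<^sub>k\<^sub>+\<^sub>1' = y\<^sub>k + x y\<^sub>k'\<close>.
\<close>
lemma pderiv_sl_poly:
  "pderiv (complex_poly (sl_poly a n)) =
     (\<Sum>k<n. [:0, 1:] ^ (n - 1 - k) * complex_poly (sl_poly a k))"
proof (induction n)
  case 0
  show ?case by (simp add: complex_poly_def sl_poly_def pderiv_pCons)
next
  case (Suc n)
  have "pderiv (complex_poly (sl_poly a (Suc n))) =
      complex_poly (sl_poly a n) + [:0, 1:] * pderiv (complex_poly (sl_poly a n))"
    by (simp add: complex_poly_sl_poly_Suc pderiv_diff pderiv_mult pderiv_pCons algebra_simps)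
  \<comment> \<open>For \<open>k < n\<close> the extra factor turns the exponent
    \<open>n - 1 - k\<close> into \<open>n - k\<close>; the other term is the summand
    \<open>k = n\<close>, with exponent 0.\<close>
  also have "[:0, 1:] * pderiv (complex_poly (sl_poly a n)) =
      (\<Sum>k<n. [:0, 1:] ^ (n - k) * complex_poly (sl_poly a k))"
    unfolding Suc.IH sum_distrib_left
    by (intro sum.cong refl)
      (simp add: mult.assoc[symmetric] power_Suc[symmetric] Suc_diff_Suc del: power_Suc)
  finally show ?case by (simp add: add.commute)
qed

text \<open>A power of a linear factor dividing the list divides its image under
  \<open>complex_poly\<close>. This carries the multiplicity hypothesis over to
  \<open>order\<close>.\<close>

lemma order_ge_alg_mult:
  assumes "l \<in> carrier (UNIV[X]\<^bsub>\<C>\<^esub>)" "l \<noteq> []"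
  shows "order z (complex_poly l) \<ge> ring.alg_mult \<C> l z"
proof -
  interpret C: domain \<C> by (rule complex_ring_domain)
  have "([1, - z] [^]\<^bsub>UNIV[X]\<^bsub>\<C>\<^esub>\<^esub> C.alg_mult l z) divides\<^bsub>UNIV[X]\<^bsub>\<C>\<^esub>\<^esub> l"
    using C.alg_multE(1)[of z l] assms by (simp add: pdivides_def)
  then obtain c where "l = [1, - z] [^]\<^bsub>UNIV[X]\<^bsub>\<C>\<^esub>\<^esub> C.alg_mult l z \<otimes>\<^bsub>UNIV[X]\<^bsub>\<C>\<^esub>\<^esub> c"
    by (auto simp: factor_def)
  then have "complex_poly l = [:- z, 1:] ^ C.alg_mult l z * complex_poly c"
    by (metis complex_poly_mult complex_poly_pow complex_poly_def rev.simps append.simps Poly.simps)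
  moreover have "complex_poly l \<noteq> 0"
    using rev_coeffs_complex_poly[OF assms(1)] assms(2) by auto
  ultimately show ?thesis
    by (metis dvd_triv_left order_divides)
qed

text \<open>The quotient map is a ring homomorphism, so the sum can be formed on representatives,
  where \<open>pderiv_sl_poly\<close> identifies it.\<close>

lemma genus_reduction_eq_class:
  obtains l where "l \<in> carrier ((coeff_ring n a)[X]\<^bsub>\<C>\<^esub>)"
    "genus_reduction n a = sl_class n a l"
    "complex_poly l = pderiv (complex_poly (sl_poly a n))"
proof -
  let ?P = "(coeff_ring n a)[X]\<^bsub>\<C>\<^esub>"
  interpret h: ring_hom_ring ?P "sl_ext n a" "sl_class n a"
    by (rule sl_class_hom)
  define t where "t k = X\<^bsub>\<C>\<^esub> [^]\<^bsub>?P\<^esub> (n - 1 - k) \<otimes>\<^bsub>?P\<^esub> sl_poly a k" for k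
  have X: "X\<^bsub>\<C>\<^esub> \<in> carrier ?P"
    using domain.var_closed(1)[OF complex_ring_domain coeff_ring_subring] .
  have t: "t k \<in> carrier ?P" if "k < n" for k
    using X sl_poly_closed[of k n a] that by (simp add: t_def)
  have "genus_reduction n a = finsum (sl_ext n a) (\<lambda>k. sl_class n a (t k)) {..<n}"
    unfolding genus_reduction_def
  proof (rule h.S.add.finprod_cong')
    show "(\<lambda>k. sl_class n a (t k)) \<in> {..<n} \<rightarrow> carrier (sl_ext n a)"
      using t by auto
  next
    fix k assume "k \<in> {..<n}"
    then show "dual_x n a k \<otimes>\<^bsub>sl_ext n a\<^esub> dual_y n a k = sl_class n a (t k)"
      using X sl_poly_closed[of k n a] by (simp add: dual_x_def dual_y_def t_def h.hom_nat_pow)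
  qed simp
  also have "\<dots> = sl_class n a (finsum ?P t {..<n})"
    using t by (subst h.hom_finsum) (auto simp: o_def)
  finally have *: "genus_reduction n a = sl_class n a (finsum ?P t {..<n})" .
  \<comment> \<open>The bound \<open>m \<le> n\<close> keeps the summands in the carrier, which is
    known only for \<open>k < n\<close>.\<close>
  have "complex_poly (finsum ?P t {..<m}) = (\<Sum>k<m. complex_poly (t k))" if "m \<le> n" for m
    using that
  proof (induction m)
    case 0
    show ?case by (simp add: univ_poly_zero)
  next
    case (Suc m)
    have "finsum ?P t {..<Suc m} = t m \<oplus>\<^bsub>?P\<^esub> finsum ?P t {..<m}"
      using Suc.prems t unfolding lessThan_Suc by (intro h.R.finsum_insert) auto
    then show ?case using Suc by (simp add: complex_poly_add add.commute)
  qed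
  then have "complex_poly (finsum ?P t {..<n}) = pderiv (complex_poly (sl_poly a n))"
    by (simp add: pderiv_sl_poly t_def complex_poly_mult complex_poly_pow complex_poly_var)
  moreover have "finsum ?P t {..<n} \<in> carrier ?P"
    using t by (intro h.R.finsum_closed) auto
  ultimately show ?thesis using that * by blast
qed

section \<open>Vanishing in the quotient ring\<close>

text \<open>The complex quotient has coefficients in \<open>coeff_ring n a\<close> because
  \<open>sl_poly a n\<close> is monic, so \<open>l\<close> lies in the principal ideal already over
  that subring.\<close>

lemma sl_class_eq_zero:
  assumes l: "l \<in> carrier ((coeff_ring n a)[X]\<^bsub>\<C>\<^esub>)"
    and dvd: "complex_poly (sl_poly a n) dvd complex_poly l"
  shows "sl_class n a l = \<zero>\<^bsub>sl_ext n a\<^esub>"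
proof -
  let ?K = "coeff_ring n a" and ?P = "(coeff_ring n a)[X]\<^bsub>\<C>\<^esub>"
  interpret P: domain ?P
    using domain.univ_poly_is_domain[OF complex_ring_domain coeff_ring_subring] .
  have p: "sl_poly a n \<in> carrier ?P" by (rule sl_poly_closed) simp
  obtain q where q: "complex_poly l = complex_poly (sl_poly a n) * q"
    using dvd by (auto elim: dvdE)
  have "coeffs (complex_poly (sl_poly a n)) = rev (sl_poly a n)"
    using rev_coeffs_complex_poly[OF p] by (metis rev_rev_ident)
  then have "Polynomial.lead_coeff (complex_poly (sl_poly a n)) = 1"
    by (metis last_coeffs_eq_coeff_degree coeffs_eq_Nil hd_rev last_rev list.sel(1) rev_is_Nil_conv
        sl_poly_def list.distinct(1))
  then have "poly.coeff q i \<in> ?K" for i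
    by (rule monic_quotient_coeffs[OF coeff_ring_subring])
      (use q l p in \<open>auto simp flip: q intro!: complex_poly_coeff_closed[OF coeff_ring_subring]\<close>)
  then have qc: "rev (coeffs q) \<in> carrier ?P" by (rule rev_coeffs_closed)
  have "complex_poly (rev (coeffs q) \<otimes>\<^bsub>?P\<^esub> sl_poly a n) = complex_poly l"
    by (simp add: complex_poly_mult q mult.commute)
  \<comment> \<open>Both sides lie in the carrier and have the same image, so injectivity of
    \<open>complex_poly\<close> applies.\<close>
  then have "l = rev (coeffs q) \<otimes>\<^bsub>?P\<^esub> sl_poly a n"
    by (metis rev_coeffs_complex_poly l P.m_closed qc p)
  then have "l \<in> PIdl\<^bsub>?P\<^esub> (sl_poly a n)"
    using qc by (auto simp: cgenideal_def)
  then have "PIdl\<^bsub>?P\<^esub> (sl_poly a n) +>\<^bsub>?P\<^esub> l = PIdl\<^bsub>?P\<^esub> (sl_poly a n)"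
    by (intro P.a_coset_join2 l additive_subgroup.a_subgroup ideal.axioms(1) P.cgenideal_ideal p)
  then show ?thesis
    by (simp add: sl_class_def sl_ext_def rupture_def FactRing_def)
qed

theorem theorem4p4:
  fixes n :: nat and a :: "nat \<Rightarrow> complex"
  assumes "n \<ge> 2"
    and "\<And>z. ring.is_root \<C> (sl_poly a n) z \<Longrightarrow> ring.alg_mult \<C> (sl_poly a n) z \<ge> 2"
  shows "genus_reduction n a [^]\<^bsub>sl_ext n a\<^esub> (2::nat) = \<zero>\<^bsub>sl_ext n a\<^esub>"
proof -
  let ?P = "(coeff_ring n a)[X]\<^bsub>\<C>\<^esub>" and ?p = "complex_poly (sl_poly a n)"
  interpret C: domain \<C> by (rule complex_ring_domain)
  interpret h: ring_hom_ring ?P "sl_ext n a" "sl_class n a"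
    by (rule sl_class_hom)
  have nz: "sl_poly a n \<noteq> []" by (simp add: sl_poly_def)
  \<comment> \<open>Root multiplicities refer to polynomials over all complex numbers, so the list
    is viewed there rather than over \<open>coeff_ring n a\<close>.\<close>
  have p: "sl_poly a n \<in> carrier (UNIV[X]\<^bsub>\<C>\<^esub>)"
    by (simp add: univ_poly_carrier[symmetric] polynomial_def sl_poly_def)
  have "?p \<noteq> 0"
    using rev_coeffs_complex_poly[OF p] nz by auto
  moreover have "order z ?p \<ge> 2" if "poly ?p z = 0" for z
  proof -
    have "C.is_root (sl_poly a n) z"
      using that nz by (simp add: C.is_root_def poly_complex_poly)
    then show ?thesis
      using assms(2)[of z] order_ge_alg_mult[OF p nz, of z] by linarith
  qed
  ultimately have dvd: "?p dvd (pderiv ?p)\<^sup>2" by (rule dvd_pderiv_squared)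
  obtain l where l: "l \<in> carrier ?P" "genus_reduction n a = sl_class n a l"
    "complex_poly l = pderiv ?p"
    by (rule genus_reduction_eq_class)
  have "genus_reduction n a [^]\<^bsub>sl_ext n a\<^esub> (2::nat) = sl_class n a (l [^]\<^bsub>?P\<^esub> (2::nat))"
    using l by (simp add: h.hom_nat_pow)
  also have "\<dots> = \<zero>\<^bsub>sl_ext n a\<^esub>"
    using l dvd by (intro sl_class_eq_zero) (simp_all add: complex_poly_pow)
  finally show ?thesis .
qed

end
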